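(* There are terms $s,t$ of Gödel's system $T$ of lowest level such that $$(\forall\Theta)\big(\mathsf{SFF}(\Theta)\to\mathsf{SCF}(t(\Theta))\big)\wedge(\forall\nu)\big(\mathsf{SCF}(\nu)\to\mathsf{SFF}(s(\nu))\big).$$
   Context: Variables $f,g,\alpha,\beta$ with "$\le1$" range over $2^{\mathbb N}$; $T\le 1$ ranges over binary trees (sets of finite binary sequences closed under initial segments, coded as type-1 objects); $\bar\alpha n=\langle\alpha(0),\dots,\alpha(n-1)\rangle$; $f\in[\sigma]$ means $\bar f|\sigma|=\sigma$. $\mathsf{SFF}(\Theta)$ for $\Theta$ of type $2\to1^*$ (finite sequences of type-1 objects): $(\forall G^2)(\forall f\le1)(\exists g\in\Theta(G))(f\in[\bar g G(g)])$. $\mathsf{SCF}(\nu)$ for $\nu$ of type $2\to(0\times1^* )$, writing $\nu(g)=(\nu(g)(1),\nu(g)(2))$: $(\forall g^2,T\le1)\big[(\forall\alpha\in\nu(g)(2))(\bar\alpha g(\alpha)\notin T)\to(\forall\beta\le1)(\exists i\le\nu(g)(1))(\bar\beta i\notin T)\big]$. *)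

theory Defs
  imports Main "HOL-Library.Sublist"
begin

section \<open>The specifications SFF and SCF\<close>

text \<open>Type 0 is \<^typ>\<open>nat\<close>, type 1 is \<^typ>\<open>nat \<Rightarrow> nat\<close>, type 2 is \<^typ>\<open>(nat \<Rightarrow> nat) \<Rightarrow> nat\<close>, all with
  full function spaces. Finite sequences are lists, and trees are sets of number lists rather than
  characteristic functions on sequence codes.\<close>

definition binary :: "(nat \<Rightarrow> nat) \<Rightarrow> bool" where
  "binary f \<longleftrightarrow> (\<forall>n. f n \<le> 1)"

definition seg :: "(nat \<Rightarrow> nat) \<Rightarrow> nat \<Rightarrow> nat list" where
  "seg \<alpha> n = map \<alpha> [0..<n]"

definition cylinder :: "nat list \<Rightarrow> (nat \<Rightarrow> nat) set" where
  "cylinder \<sigma> = {f. seg f (length \<sigma>) = \<sigma>}"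

definition binary_tree :: "nat list set \<Rightarrow> bool" where
  "binary_tree T \<longleftrightarrow> (\<forall>\<sigma>\<in>T. set \<sigma> \<subseteq> {0, 1}) \<and> (\<forall>\<sigma>\<in>T. \<forall>\<tau>. prefix \<tau> \<sigma> \<longrightarrow> \<tau> \<in> T)"

definition SFF :: "(((nat \<Rightarrow> nat) \<Rightarrow> nat) \<Rightarrow> (nat \<Rightarrow> nat) list) \<Rightarrow> bool" where
  "SFF \<Theta> \<longleftrightarrow> (\<forall>G f. binary f \<longrightarrow> (\<exists>g\<in>set (\<Theta> G). f \<in> cylinder (seg g (G g))))"

definition SCF :: "(((nat \<Rightarrow> nat) \<Rightarrow> nat) \<Rightarrow> nat \<times> (nat \<Rightarrow> nat) list) \<Rightarrow> bool" where
  "SCF \<nu> \<longleftrightarrow> (\<forall>g T. binary_tree T \<longrightarrow>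
     (\<forall>\<alpha>\<in>set (snd (\<nu> g)). seg \<alpha> (g \<alpha>) \<notin> T) \<longrightarrow>
     (\<forall>\<beta>. binary \<beta> \<longrightarrow> (\<exists>i\<le>fst (\<nu> g). seg \<beta> i \<notin> T)))"

section \<open>Terms of Goedel's system T of lowest level\<close>

datatype ty = N | Arr ty ty (infixr \<open>\<rightarrow>\<^sub>T\<close> 60) | Prod ty ty (infixr \<open>\<times>\<^sub>T\<close> 65) | Star ty

abbreviation ty1 :: ty where "ty1 \<equiv> N \<rightarrow>\<^sub>T N"
abbreviation ty2 :: ty where "ty2 \<equiv> ty1 \<rightarrow>\<^sub>T N"

text \<open>Variables are de Bruijn indices. \<open>Rec a b n\<close> is the recursor $R_0$, with
  $R_0(a,b,0) = a$ and $R_0(a,b,n+1) = b(R_0(a,b,n),n)$; \<open>SRec a b s\<close> is its analogue for a finite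
  sequence $s$. \<open>Lowest level\<close> means that both produce objects of type 0 only, whereas
  abstraction, application, pairing and sequences are available at all finite types.\<close>

datatype tm = Var nat | Lam ty tm | App tm tm
  | Zero | Succ tm | Rec tm tm tm
  | MkPair tm tm | Fst tm | Snd tm
  | SNil ty | SCons tm tm | SRec tm tm tm

inductive has_type :: "ty list \<Rightarrow> tm \<Rightarrow> ty \<Rightarrow> bool" (\<open>_ \<turnstile> _ : _\<close> [50, 50, 50] 50) where
  "i < length \<Gamma> \<Longrightarrow> \<Gamma> \<turnstile> Var i : \<Gamma> ! i"
| "\<sigma> # \<Gamma> \<turnstile> b : \<tau> \<Longrightarrow> \<Gamma> \<turnstile> Lam \<sigma> b : \<sigma> \<rightarrow>\<^sub>T \<tau>"
| "\<Gamma> \<turnstile> f : \<sigma> \<rightarrow>\<^sub>T \<tau> \<Longrightarrow> \<Gamma> \<turnstile> a : \<sigma> \<Longrightarrow> \<Gamma> \<turnstile> App f a : \<tau>"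
| "\<Gamma> \<turnstile> Zero : N"
| "\<Gamma> \<turnstile> n : N \<Longrightarrow> \<Gamma> \<turnstile> Succ n : N"
| "\<Gamma> \<turnstile> a : N \<Longrightarrow> \<Gamma> \<turnstile> b : N \<rightarrow>\<^sub>T N \<rightarrow>\<^sub>T N \<Longrightarrow> \<Gamma> \<turnstile> n : N \<Longrightarrow> \<Gamma> \<turnstile> Rec a b n : N"
| "\<Gamma> \<turnstile> a : \<sigma> \<Longrightarrow> \<Gamma> \<turnstile> b : \<tau> \<Longrightarrow> \<Gamma> \<turnstile> MkPair a b : \<sigma> \<times>\<^sub>T \<tau>"
| "\<Gamma> \<turnstile> p : \<sigma> \<times>\<^sub>T \<tau> \<Longrightarrow> \<Gamma> \<turnstile> Fst p : \<sigma>"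
| "\<Gamma> \<turnstile> p : \<sigma> \<times>\<^sub>T \<tau> \<Longrightarrow> \<Gamma> \<turnstile> Snd p : \<tau>"
| "\<Gamma> \<turnstile> SNil \<sigma> : Star \<sigma>"
| "\<Gamma> \<turnstile> a : \<sigma> \<Longrightarrow> \<Gamma> \<turnstile> s : Star \<sigma> \<Longrightarrow> \<Gamma> \<turnstile> SCons a s : Star \<sigma>"
| "\<Gamma> \<turnstile> a : N \<Longrightarrow> \<Gamma> \<turnstile> b : N \<rightarrow>\<^sub>T \<sigma> \<rightarrow>\<^sub>T N \<Longrightarrow> \<Gamma> \<turnstile> s : Star \<sigma> \<Longrightarrow> \<Gamma> \<turnstile> SRec a b s : N"

section \<open>Application of terms to functionals\<close>

text \<open>The full type structure over all finite types at once does not fit into a single HOL type, so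
  terms are not interpreted by a valuation into such a type. Instead they are evaluated with
  arbitrary set-theoretic functionals as arguments: a function value is either a closure or one of
  \<open>Fun1\<close>, \<open>Fun2\<close>, \<open>Fun3\<close>, a completely arbitrary HOL function whose argument is of type 0, 1, 2
  respectively. Applying \<open>Fun2 F\<close> to a value \<open>v\<close> of type 1 yields \<open>F\<close> at the function \<open>f\<close> that \<open>v\<close>
  computes, and likewise for \<open>Fun3\<close>; these rules have one premise for each argument of
  \<open>f\<close> (respectively \<open>G\<close>).\<close>

datatype val = Num nat | PairV val val | SeqV "val list" | Clo tm "val list"
  | Fun1 "nat \<Rightarrow> val" | Fun2 "(nat \<Rightarrow> nat) \<Rightarrow> val" | Fun3 "((nat \<Rightarrow> nat) \<Rightarrow> nat) \<Rightarrow> val"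

definition val1 :: "(nat \<Rightarrow> nat) \<Rightarrow> val" where
  "val1 f = Fun1 (\<lambda>n. Num (f n))"

definition val2 :: "((nat \<Rightarrow> nat) \<Rightarrow> nat) \<Rightarrow> val" where
  "val2 G = Fun2 (\<lambda>f. Num (G f))"

inductive
  eval :: "val list \<Rightarrow> tm \<Rightarrow> val \<Rightarrow> bool" and
  appl :: "val \<Rightarrow> val \<Rightarrow> val \<Rightarrow> bool" and
  recn :: "val \<Rightarrow> val \<Rightarrow> nat \<Rightarrow> val \<Rightarrow> bool" and
  recs :: "val \<Rightarrow> val \<Rightarrow> val list \<Rightarrow> val \<Rightarrow> bool"
where
  "i < length \<rho> \<Longrightarrow> eval \<rho> (Var i) (\<rho> ! i)"
| "eval \<rho> (Lam \<sigma> b) (Clo b \<rho>)"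
| "eval \<rho> f u \<Longrightarrow> eval \<rho> a w \<Longrightarrow> appl u w v \<Longrightarrow> eval \<rho> (App f a) v"
| "eval \<rho> Zero (Num 0)"
| "eval \<rho> n (Num k) \<Longrightarrow> eval \<rho> (Succ n) (Num (Suc k))"
| "eval \<rho> a u \<Longrightarrow> eval \<rho> b w \<Longrightarrow> eval \<rho> n (Num k) \<Longrightarrow> recn u w k v \<Longrightarrow> eval \<rho> (Rec a b n) v"
| "eval \<rho> a u \<Longrightarrow> eval \<rho> b w \<Longrightarrow> eval \<rho> (MkPair a b) (PairV u w)"
| "eval \<rho> p (PairV u w) \<Longrightarrow> eval \<rho> (Fst p) u"
| "eval \<rho> p (PairV u w) \<Longrightarrow> eval \<rho> (Snd p) w"
| "eval \<rho> (SNil \<sigma>) (SeqV [])"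
| "eval \<rho> a u \<Longrightarrow> eval \<rho> s (SeqV us) \<Longrightarrow> eval \<rho> (SCons a s) (SeqV (u # us))"
| "eval \<rho> a u \<Longrightarrow> eval \<rho> b w \<Longrightarrow> eval \<rho> s (SeqV us) \<Longrightarrow> recs u w us v \<Longrightarrow> eval \<rho> (SRec a b s) v"
| "eval (w # \<rho>) b v \<Longrightarrow> appl (Clo b \<rho>) w v"
| "appl (Fun1 F) (Num n) (F n)"
| "(\<And>n. appl w (Num n) (Num (f n))) \<Longrightarrow> appl (Fun2 F) w (F f)"
| "(\<And>f. appl w (val1 f) (Num (G f))) \<Longrightarrow> appl (Fun3 F) w (F G)"
| "recn u w 0 u"
| "recn u w k r \<Longrightarrow> appl w r h \<Longrightarrow> appl h (Num k) v \<Longrightarrow> recn u w (Suc k) v"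
| "recs u w [] u"
| "recs u w us r \<Longrightarrow> appl w r h \<Longrightarrow> appl h x v \<Longrightarrow> recs u w (x # us) v"

inductive_cases eval_VarE: "eval \<rho> (Var i) v"
inductive_cases eval_LamE: "eval \<rho> (Lam \<sigma> b) v"
inductive_cases eval_AppE: "eval \<rho> (App f a) v"
inductive_cases eval_ZeroE: "eval \<rho> Zero v"
inductive_cases eval_SuccE: "eval \<rho> (Succ n) v"
inductive_cases eval_RecE: "eval \<rho> (Rec a b n) v"
inductive_cases eval_MkPairE: "eval \<rho> (MkPair a b) v"
inductive_cases eval_FstE: "eval \<rho> (Fst p) v"
inductive_cases eval_SndE: "eval \<rho> (Snd p) v"
inductive_cases eval_SNilE: "eval \<rho> (SNil \<sigma>) v"
inductive_cases eval_SConsE: "eval \<rho> (SCons a s) v"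
inductive_cases eval_SRecE: "eval \<rho> (SRec a b s) v"
inductive_cases appl_CloE: "appl (Clo b \<rho>) w v"
inductive_cases appl_Fun1E: "appl (Fun1 F) w v"
inductive_cases appl_Fun2E: "appl (Fun2 F) w v"
inductive_cases appl_Fun3E: "appl (Fun3 F) w v"
inductive_cases recn_0E: "recn u w 0 v"
inductive_cases recn_SucE: "recn u w (Suc k) v"
inductive_cases recs_NilE: "recs u w [] v"
inductive_cases recs_ConsE: "recs u w (x # us) v"

definition reads1 :: "val \<Rightarrow> (nat \<Rightarrow> nat) \<Rightarrow> bool" where
  "reads1 v f \<longleftrightarrow> (\<forall>n. appl v (Num n) (Num (f n)))"

definition reads_seq :: "val \<Rightarrow> (nat \<Rightarrow> nat) list \<Rightarrow> bool" where
  "reads_seq v fs \<longleftrightarrow> (\<exists>vs. v = SeqV vs \<and> list_all2 reads1 vs fs)"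

definition reads_pair :: "val \<Rightarrow> nat \<times> (nat \<Rightarrow> nat) list \<Rightarrow> bool" where
  "reads_pair v p \<longleftrightarrow> (\<exists>w. v = PairV (Num (fst p)) w \<and> reads_seq w (snd p))"

definition val_SFF :: "(((nat \<Rightarrow> nat) \<Rightarrow> nat) \<Rightarrow> (nat \<Rightarrow> nat) list) \<Rightarrow> val" where
  "val_SFF \<Theta> = Fun3 (\<lambda>G. SeqV (map val1 (\<Theta> G)))"

definition val_SCF :: "(((nat \<Rightarrow> nat) \<Rightarrow> nat) \<Rightarrow> nat \<times> (nat \<Rightarrow> nat) list) \<Rightarrow> val" where
  "val_SCF \<nu> = Fun3 (\<lambda>G. PairV (Num (fst (\<nu> G))) (SeqV (map val1 (snd (\<nu> G)))))"

text \<open>For a closed term \<open>t\<close> of type $(2 \to 1^*) \to 2 \to 0 \times 1^*$, \<open>app_SFF t \<Theta>\<close> is the functional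
  $t(\Theta)$; for a closed term \<open>s\<close> of type $(2 \to 0 \times 1^*) \to 2 \to 1^*$, \<open>app_SCF s \<nu>\<close> is the
  functional $s(\nu)$. The descriptions are always proper, see \<open>app_SFF_welldef\<close> and
  \<open>app_SCF_welldef\<close>.\<close>

definition app_SFF :: "tm \<Rightarrow> (((nat \<Rightarrow> nat) \<Rightarrow> nat) \<Rightarrow> (nat \<Rightarrow> nat) list)
    \<Rightarrow> ((nat \<Rightarrow> nat) \<Rightarrow> nat) \<Rightarrow> nat \<times> (nat \<Rightarrow> nat) list" where
  "app_SFF t \<Theta> G =
     (THE p. \<exists>v. eval [val_SFF \<Theta>, val2 G] (App (App t (Var 0)) (Var 1)) v \<and> reads_pair v p)"

definition app_SCF :: "tm \<Rightarrow> (((nat \<Rightarrow> nat) \<Rightarrow> nat) \<Rightarrow> nat \<times> (nat \<Rightarrow> nat) list)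
    \<Rightarrow> ((nat \<Rightarrow> nat) \<Rightarrow> nat) \<Rightarrow> (nat \<Rightarrow> nat) list" where
  "app_SCF s \<nu> G =
     (THE fs. \<exists>v. eval [val_SCF \<nu>, val2 G] (App (App s (Var 0)) (Var 1)) v \<and> reads_seq v fs)"

section \<open>Evaluation is deterministic, and total on typed terms\<close>

lemma det_all:
  "eval \<rho> t v \<Longrightarrow> \<forall>v'. eval \<rho> t v' \<longrightarrow> v' = v"
  "appl x y z \<Longrightarrow> \<forall>z'. appl x y z' \<longrightarrow> z' = z"
  "recn a b n c \<Longrightarrow> \<forall>c'. recn a b n c' \<longrightarrow> c' = c"
  "recs d e xs q \<Longrightarrow> \<forall>q'. recs d e xs q' \<longrightarrow> q' = q"
proof (induction rule: eval_appl_recn_recs.inducts)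
  case (1 i \<rho>) then show ?case by (blast elim: eval_VarE)
next
  case (2 \<rho> \<sigma> b) then show ?case by (blast elim: eval_LamE)
next
  case (3 \<rho> f u a w v) then show ?case by (blast elim: eval_AppE)
next
  case (4 \<rho>) then show ?case by (blast elim: eval_ZeroE)
next
  case (5 \<rho> n k) then show ?case by (blast elim: eval_SuccE)
next
  case (6 \<rho> a u b w n k v) then show ?case by (blast elim: eval_RecE)
next
  case (7 \<rho> a u b w) then show ?case by (blast elim: eval_MkPairE)
next
  case (8 \<rho> p u w) then show ?case by (blast elim: eval_FstE)
next
  case (9 \<rho> p u w) then show ?case by (blast elim: eval_SndE)
next
  case (10 \<rho> \<sigma>) then show ?case by (blast elim: eval_SNilE)
next
  case (11 \<rho> a u s us) then show ?case by (blast elim: eval_SConsE)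
next
  case (12 \<rho> a u b w s us v) then show ?case by (blast elim: eval_SRecE)
next
  case (13 w \<rho> b v) then show ?case by (blast elim: appl_CloE)
next
  case (14 F n) then show ?case by (blast elim: appl_Fun1E)
next
  case (15 w f F)
  have "z' = F f" if z': "appl (Fun2 F) w z'" for z'
  proof -
    obtain f' where v: "z' = F f'" and f': "\<forall>n. appl w (Num n) (Num (f' n))"
      using z' by (rule appl_Fun2E) simp
    have "Num (f' n) = Num (f n)" for n using 15(2) f' by blast
    then have "f' = f" by auto
    then show ?thesis using v by simp
  qed
  then show ?case by blast
next
  case (16 w G F)
  have "z' = F G" if z': "appl (Fun3 F) w z'" for z'
  proof -
    obtain G' where v: "z' = F G'" and G': "\<forall>f. appl w (val1 f) (Num (G' f))"
      using z' by (rule appl_Fun3E) simp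
    have "Num (G' f) = Num (G f)" for f using 16(2) G' by blast
    then have "G' = G" by auto
    then show ?thesis using v by simp
  qed
  then show ?case by blast
next
  case (17 u w) then show ?case by (blast elim: recn_0E)
next
  case (18 u w k r h v) then show ?case by (blast elim: recn_SucE)
next
  case (19 u w) then show ?case by (blast elim: recs_NilE)
next
  case (20 u w us r h x v) then show ?case by (blast elim: recs_ConsE)
qed

lemma eval_det: "eval \<rho> t v \<Longrightarrow> eval \<rho> t v' \<Longrightarrow> v' = v"
  using det_all(1) by blast

lemma appl_det: "appl x y z \<Longrightarrow> appl x y z' \<Longrightarrow> z' = z"
  using det_all(2) by blast

primrec tot :: "ty \<Rightarrow> val \<Rightarrow> bool" where
  "tot N v \<longleftrightarrow> (\<exists>n. v = Num n)"
| "tot (\<sigma> \<rightarrow>\<^sub>T \<tau>) v \<longleftrightarrow> (\<forall>w. tot \<sigma> w \<longrightarrow> (\<exists>u. appl v w u \<and> tot \<tau> u))"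
| "tot (\<sigma> \<times>\<^sub>T \<tau>) v \<longleftrightarrow> (\<exists>u w. v = PairV u w \<and> tot \<sigma> u \<and> tot \<tau> w)"
| "tot (Star \<sigma>) v \<longleftrightarrow> (\<exists>vs. v = SeqV vs \<and> (\<forall>u\<in>set vs. tot \<sigma> u))"

lemma recn_total:
  assumes "tot N u" "tot (N \<rightarrow>\<^sub>T N \<rightarrow>\<^sub>T N) w"
  shows "\<exists>v. recn u w k v \<and> tot N v"
proof (induction k)
  case 0
  then show ?case using assms(1) eval_appl_recn_recs.intros(17) by blast
next
  case (Suc k)
  then obtain r where r: "recn u w k r" "tot N r" by blast
  then obtain h where h: "appl w r h" "tot (N \<rightarrow>\<^sub>T N) h" using assms(2) by (metis tot.simps(2))
  moreover have "tot N (Num k)" by simp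
  ultimately obtain v where "appl h (Num k) v" "tot N v" by (metis tot.simps(2))
  then show ?case using r h eval_appl_recn_recs.intros(18) by blast
qed

lemma recs_total:
  assumes "tot N u" "tot (N \<rightarrow>\<^sub>T \<sigma> \<rightarrow>\<^sub>T N) w" "\<forall>x\<in>set us. tot \<sigma> x"
  shows "\<exists>v. recs u w us v \<and> tot N v"
  using assms(3)
proof (induction us)
  case Nil
  then show ?case using assms(1) eval_appl_recn_recs.intros(19) by blast
next
  case (Cons x us)
  then obtain r where r: "recs u w us r" "tot N r" by auto
  then obtain h where h: "appl w r h" "tot (\<sigma> \<rightarrow>\<^sub>T N) h" using assms(2) by (metis tot.simps(2))
  moreover have "tot \<sigma> x" using Cons by simp
  ultimately obtain v where "appl h x v" "tot N v" by (metis tot.simps(2))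
  then show ?case using r h eval_appl_recn_recs.intros(20) by blast
qed

lemma eval_total:
  assumes "\<Gamma> \<turnstile> t : \<tau>" and "length \<Gamma> \<le> length \<rho>" and "\<And>i. i < length \<Gamma> \<Longrightarrow> tot (\<Gamma> ! i) (\<rho> ! i)"
  shows "\<exists>v. eval \<rho> t v \<and> tot \<tau> v"
  using assms
proof (induction arbitrary: \<rho> rule: has_type.induct)
  case (1 i \<Gamma>)
  then show ?case using eval_appl_recn_recs.intros(1)[of i \<rho>] by auto
next
  case (2 \<sigma> \<Gamma> b \<tau>)
  have "\<exists>u. appl (Clo b \<rho>) w u \<and> tot \<tau> u" if "tot \<sigma> w" for w
  proof -
    have "\<exists>v. eval (w # \<rho>) b v \<and> tot \<tau> v"
      using 2(3,4) that by (intro 2(2)) (auto simp: nth_Cons split: nat.split)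
    then show ?thesis using eval_appl_recn_recs.intros(13) by blast
  qed
  then have "tot (\<sigma> \<rightarrow>\<^sub>T \<tau>) (Clo b \<rho>)" by simp
  then show ?case using eval_appl_recn_recs.intros(2) by blast
next
  case (3 \<Gamma> f \<sigma> \<tau> a)
  then obtain u w where "eval \<rho> f u" "tot (\<sigma> \<rightarrow>\<^sub>T \<tau>) u" "eval \<rho> a w" "tot \<sigma> w" by meson
  moreover from this obtain v where "appl u w v" "tot \<tau> v" by auto
  ultimately show ?case by (blast intro: eval_appl_recn_recs.intros(3))
next
  case (4 \<Gamma>)
  show ?case using eval_appl_recn_recs.intros(4)[of \<rho>] by auto
next
  case (5 \<Gamma> n)
  then obtain k where "eval \<rho> n (Num k)" by (metis tot.simps(1))
  then have "eval \<rho> (Succ n) (Num (Suc k))" by (rule eval_appl_recn_recs.intros(5))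
  then show ?case by auto
next
  case (6 \<Gamma> a b n)
  obtain u w x where *: "eval \<rho> a u" "tot N u" "eval \<rho> b w" "tot (N \<rightarrow>\<^sub>T N \<rightarrow>\<^sub>T N) w" "eval \<rho> n x" "tot N x"
    using 6 by meson
  then obtain k where "x = Num k" by auto
  then show ?case using * recn_total[of u w k] eval_appl_recn_recs.intros(6) by blast
next
  case (7 \<Gamma> a \<sigma> b \<tau>)
  then obtain u w where "eval \<rho> a u" "tot \<sigma> u" "eval \<rho> b w" "tot \<tau> w" by meson
  moreover from this have "eval \<rho> (MkPair a b) (PairV u w)" by (blast intro: eval_appl_recn_recs.intros(7))
  ultimately show ?case by auto
next
  case (8 \<Gamma> p \<sigma> \<tau>)
  obtain v where v: "eval \<rho> p v" "tot (\<sigma> \<times>\<^sub>T \<tau>) v" using 8 by blast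
  then obtain u w where "v = PairV u w" "tot \<sigma> u" "tot \<tau> w" by auto
  then show ?case using v eval_appl_recn_recs.intros(8) by blast
next
  case (9 \<Gamma> p \<sigma> \<tau>)
  obtain v where v: "eval \<rho> p v" "tot (\<sigma> \<times>\<^sub>T \<tau>) v" using 9 by blast
  then obtain u w where "v = PairV u w" "tot \<sigma> u" "tot \<tau> w" by auto
  then show ?case using v eval_appl_recn_recs.intros(9) by blast
next
  case (10 \<Gamma> \<sigma>)
  show ?case using eval_appl_recn_recs.intros(10)[of \<rho> \<sigma>] by auto
next
  case (11 \<Gamma> a \<sigma> s)
  obtain u x where *: "eval \<rho> a u" "tot \<sigma> u" "eval \<rho> s x" "tot (Star \<sigma>) x"
    using 11 by meson
  then obtain us where "x = SeqV us" "\<forall>u\<in>set us. tot \<sigma> u" by auto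
  moreover from this have "eval \<rho> (SCons a s) (SeqV (u # us))"
    using * by (blast intro: eval_appl_recn_recs.intros(11))
  ultimately show ?case using * by auto
next
  case (12 \<Gamma> a b \<sigma> s)
  obtain u w x where *: "eval \<rho> a u" "tot N u" "eval \<rho> b w" "tot (N \<rightarrow>\<^sub>T \<sigma> \<rightarrow>\<^sub>T N) w"
      "eval \<rho> s x" "tot (Star \<sigma>) x"
    using 12 by meson
  then obtain us where "x = SeqV us" "\<forall>u\<in>set us. tot \<sigma> u" by auto
  then show ?case using * recs_total[of u \<sigma> w us] eval_appl_recn_recs.intros(12) by blast
qed

lemma reads1_total: "tot ty1 v \<longleftrightarrow> (\<exists>f. reads1 v f)"
proof -
  have "tot ty1 v \<longleftrightarrow> (\<forall>n. \<exists>m. appl v (Num n) (Num m))" by auto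
  then show ?thesis by (simp add: reads1_def choice_iff)
qed

lemma tot_val1: "tot ty1 (val1 f)"
  using reads1_total reads1_def val1_def eval_appl_recn_recs.intros(14) by metis

lemma tot_Fun2: "(\<And>f. tot \<tau> (F f)) \<Longrightarrow> tot (ty1 \<rightarrow>\<^sub>T \<tau>) (Fun2 F)"
  unfolding tot.simps(2)[of ty1] reads1_total reads1_def
  using eval_appl_recn_recs.intros(15) by blast

lemma tot_Fun3: 
  assumes "\<And>G. tot \<tau> (F G)"
  shows "tot (ty2 \<rightarrow>\<^sub>T \<tau>) (Fun3 F)"
proof -
  have "\<exists>u. appl (Fun3 F) w u \<and> tot \<tau> u" if "tot ty2 w" for w
  proof -
    have "\<forall>f. \<exists>m. appl w (val1 f) (Num m)"
      using that tot_val1 by (metis tot.simps(1,2))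
    then obtain G where "\<And>f. appl w (val1 f) (Num (G f))" by metis
    then show ?thesis using assms eval_appl_recn_recs.intros(16) by blast
  qed
  then show ?thesis unfolding tot.simps(2)[of ty2] by blast
qed

lemma reads1_det: "reads1 v f \<Longrightarrow> reads1 v g \<Longrightarrow> f = g"
  unfolding reads1_def using appl_det by (metis ext val.inject(1))

lemma reads_seq_det: "reads_seq v fs \<Longrightarrow> reads_seq v gs \<Longrightarrow> fs = gs"
  unfolding reads_seq_def
  by (auto simp: list_all2_conv_all_nth intro!: nth_equalityI) (metis reads1_det)

lemma reads_seq_total: "tot (Star ty1) v \<Longrightarrow> \<exists>fs. reads_seq v fs"
  unfolding reads_seq_def tot.simps(4)[of ty1] reads1_total
  by (metis list_all2_all_nthI nth_map length_map nth_mem)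

lemma reads_pair_det: "reads_pair v p \<Longrightarrow> reads_pair v q \<Longrightarrow> p = q"
  unfolding reads_pair_def using reads_seq_det by (auto simp: prod_eq_iff)

lemma reads_pair_total: "tot (N \<times>\<^sub>T Star ty1) v \<Longrightarrow> \<exists>p. reads_pair v p"
  unfolding reads_pair_def tot.simps(3)[of N] tot.simps(1) using reads_seq_total by fastforce

lemma weaken: "\<Gamma> \<turnstile> t : \<tau> \<Longrightarrow> \<Gamma> @ \<Delta> \<turnstile> t : \<tau>"
proof (induction rule: has_type.induct)
  case (1 i \<Gamma>)
  then show ?case using has_type.intros(1)[of i "\<Gamma> @ \<Delta>"] by (simp add: nth_append)
qed (simp_all add: has_type.intros(2,4,5,6,7,10,11), (rule has_type.intros; assumption)+)

lemma eval_app2_total: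
  assumes "[] \<turnstile> t : \<sigma> \<rightarrow>\<^sub>T \<sigma>' \<rightarrow>\<^sub>T \<tau>" "tot \<sigma> x" "tot \<sigma>' y"
  shows "\<exists>v. eval [x, y] (App (App t (Var 0)) (Var 1)) v \<and> tot \<tau> v"
proof (rule eval_total)
  show "[\<sigma>, \<sigma>'] \<turnstile> App (App t (Var 0)) (Var 1) : \<tau>"
    using weaken[OF assms(1), of "[\<sigma>, \<sigma>']"] has_type.intros(1)[of 0 "[\<sigma>, \<sigma>']"]
      has_type.intros(1)[of 1 "[\<sigma>, \<sigma>']"]
    by (auto intro!: has_type.intros(3))
qed (use assms in \<open>auto simp: less_Suc_eq\<close>)

theorem app_SFF_welldef:
  assumes "[] \<turnstile> t : (ty2 \<rightarrow>\<^sub>T Star ty1) \<rightarrow>\<^sub>T ty2 \<rightarrow>\<^sub>T N \<times>\<^sub>T Star ty1"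
  shows "\<exists>!p. \<exists>v. eval [val_SFF \<Theta>, val2 G] (App (App t (Var 0)) (Var 1)) v \<and> reads_pair v p"
proof -
  have "tot (ty2 \<rightarrow>\<^sub>T Star ty1) (val_SFF \<Theta>)" unfolding val_SFF_def
    by (rule tot_Fun3) (unfold tot.simps(4), use tot_val1 in auto)
  moreover have "tot ty2 (val2 G)" unfolding val2_def by (rule tot_Fun2) simp
  ultimately obtain v p where "eval [val_SFF \<Theta>, val2 G] (App (App t (Var 0)) (Var 1)) v" "reads_pair v p"
    using eval_app2_total[OF assms] reads_pair_total by meson
  then show ?thesis by (auto dest: eval_det reads_pair_det)
qed

theorem app_SCF_welldef:
  assumes "[] \<turnstile> s : (ty2 \<rightarrow>\<^sub>T N \<times>\<^sub>T Star ty1) \<rightarrow>\<^sub>T ty2 \<rightarrow>\<^sub>T Star ty1"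
  shows "\<exists>!fs. \<exists>v. eval [val_SCF \<nu>, val2 G] (App (App s (Var 0)) (Var 1)) v \<and> reads_seq v fs"
proof -
  have "tot (ty2 \<rightarrow>\<^sub>T N \<times>\<^sub>T Star ty1) (val_SCF \<nu>)" unfolding val_SCF_def
    by (rule tot_Fun3) (unfold tot.simps(1,3,4), use tot_val1 in auto)
  moreover have "tot ty2 (val2 G)" unfolding val2_def by (rule tot_Fun2) simp
  ultimately obtain v p where "eval [val_SCF \<nu>, val2 G] (App (App s (Var 0)) (Var 1)) v" "reads_seq v p"
    using eval_app2_total[OF assms] reads_seq_total by meson
  then show ?thesis by (auto dest: eval_det reads_seq_det)
qed

end

theory Submission
  imports Defs
begin

text \<open>If \<open>\<Theta>(G)\<close> is a list of centres of a cover of Cantor space by the neighbourhoods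
  $[\bar g G(g)]$, then every binary \<open>\<beta>\<close> leaves a tree avoiding all $\bar g G(g)$ at some height
  $G(g)$, so \<open>t(\<Theta>)(G)\<close> may be taken to consist of \<open>\<Theta>(G)\<close> and the sum of these heights as a bound.
  Conversely, if \<open>f\<close> is binary and lies in none of the neighbourhoods given by
  the sequence part of \<open>\<nu>(G)\<close>, then the tree of initial segments of \<open>f\<close> refutes the specification
  of \<open>\<nu>\<close>; hence \<open>s\<close> simply projects to the sequence part.\<close>

text \<open>Iterated successor: inside the two abstractions \<open>Var 1\<close> is the value
  reached so far and \<open>Var 0\<close> the counter.\<close>

definition tm_add :: "tm \<Rightarrow> tm \<Rightarrow> tm" where
  "tm_add a n = Rec a (Lam N (Lam N (Succ (Var 1)))) n"

text \<open>Outside the recursion step, \<open>App (Var 1) (Var 0)\<close> is \<Theta>(G). Inside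
  it, \<open>Var 0\<close> is the current entry, \<open>Var 1\<close> the running sum and
  \<open>Var 2\<close> is G.\<close>

definition SFF_to_SCF :: tm where
  "SFF_to_SCF = Lam (ty2 \<rightarrow>\<^sub>T Star ty1) (Lam ty2 (MkPair
     (SRec Zero (Lam N (Lam ty1 (tm_add (Var 1) (App (Var 2) (Var 0))))) (App (Var 1) (Var 0)))
     (App (Var 1) (Var 0))))"

definition SCF_to_SFF :: tm where
  "SCF_to_SFF = Lam (ty2 \<rightarrow>\<^sub>T N \<times>\<^sub>T Star ty1) (Lam ty2 (Snd (App (Var 1) (Var 0))))"

text \<open>Stating the type through an equation lets the rule apply to any goal type and leaves the
  lookup to the simplifier.\<close>

lemma has_type_Var: "i < length \<Gamma> \<Longrightarrow> \<tau> = \<Gamma> ! i \<Longrightarrow> \<Gamma> \<turnstile> Var i : \<tau>"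
  using has_type.intros(1) by simp

lemma has_type_SFF_to_SCF:
  "[] \<turnstile> SFF_to_SCF : (ty2 \<rightarrow>\<^sub>T Star ty1) \<rightarrow>\<^sub>T ty2 \<rightarrow>\<^sub>T N \<times>\<^sub>T Star ty1"
  unfolding SFF_to_SCF_def tm_add_def
  by (rule has_type.intros(2-12) has_type_Var | simp)+

lemma has_type_SCF_to_SFF:
  "[] \<turnstile> SCF_to_SFF : (ty2 \<rightarrow>\<^sub>T N \<times>\<^sub>T Star ty1) \<rightarrow>\<^sub>T ty2 \<rightarrow>\<^sub>T Star ty1"
  unfolding SCF_to_SFF_def
  by (rule has_type.intros(2-12) has_type_Var | simp)+

lemma eval_Var: "i < length \<rho> \<Longrightarrow> v = \<rho> ! i \<Longrightarrow> eval \<rho> (Var i) v"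
  using eval_appl_recn_recs.intros(1) by simp

lemma eval_App_Var:
  assumes "i < length \<rho>" "j < length \<rho>" "appl (\<rho> ! i) (\<rho> ! j) v"
  shows "eval \<rho> (App (Var i) (Var j)) v"
  using assms by (blast intro: eval_appl_recn_recs.intros(1,3))

lemma appl_val1: "appl (val1 f) (Num n) (Num (f n))"
  unfolding val1_def by (rule eval_appl_recn_recs.intros(14))

lemma appl_val2: "appl (val2 G) (val1 f) (Num (G f))"
  unfolding val2_def by (rule eval_appl_recn_recs.intros(15)) (rule appl_val1)

lemma appl_val_SFF: "appl (val_SFF \<Theta>) (val2 G) (SeqV (map val1 (\<Theta> G)))"
  unfolding val_SFF_def by (rule eval_appl_recn_recs.intros(16)) (rule appl_val2)

lemma appl_val_SCF:
  "appl (val_SCF \<nu>) (val2 G) (PairV (Num (fst (\<nu> G))) (SeqV (map val1 (snd (\<nu> G)))))"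
  unfolding val_SCF_def by (rule eval_appl_recn_recs.intros(16)) (rule appl_val2)

lemma reads1_val1: "reads1 (val1 f) f"
  unfolding reads1_def using appl_val1 by blast

lemma reads_seq_val1: "reads_seq (SeqV (map val1 fs)) fs"
  unfolding reads_seq_def by (simp add: list_all2_conv_all_nth reads1_val1)

lemma recn_add: "recn (Num m) (Clo (Lam N (Succ (Var 1))) \<rho>) k (Num (m + k))"
proof (induction k)
  case 0
  then show ?case using eval_appl_recn_recs.intros(17) by simp
next
  case (Suc k)
  have "appl (Clo (Lam N (Succ (Var 1))) \<rho>) (Num (m + k)) (Clo (Succ (Var 1)) (Num (m + k) # \<rho>))"
    by (intro eval_appl_recn_recs.intros(2,13))
  moreover have "appl (Clo (Succ (Var 1)) (Num (m + k) # \<rho>)) (Num k) (Num (Suc (m + k)))"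
    by (intro eval_appl_recn_recs.intros(5,13) eval_Var) simp_all
  ultimately show ?case using Suc.IH eval_appl_recn_recs.intros(18) by simp
qed

lemma eval_tm_add:
  assumes "eval \<rho> a (Num m)" "eval \<rho> n (Num k)"
  shows "eval \<rho> (tm_add a n) (Num (m + k))"
  unfolding tm_add_def
  using assms recn_add by (blast intro: eval_appl_recn_recs.intros(2,6))

lemma recs_sum:
  "recs (Num 0) (Clo (Lam ty1 (tm_add (Var 1) (App (Var 2) (Var 0)))) (val2 G # \<rho>))
     (map val1 fs) (Num (\<Sum>f\<leftarrow>fs. G f))"
proof (induction fs)
  case Nil
  then show ?case using eval_appl_recn_recs.intros(19) by simp
next
  case (Cons f fs)
  let ?b = "tm_add (Var 1) (App (Var 2) (Var 0))" and ?r = "Num (\<Sum>f\<leftarrow>fs. G f)"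
  have "appl (Clo (Lam ty1 ?b) (val2 G # \<rho>)) ?r (Clo ?b (?r # val2 G # \<rho>))"
    by (intro eval_appl_recn_recs.intros(2,13))
  moreover have "eval (val1 f # ?r # val2 G # \<rho>) (App (Var 2) (Var 0)) (Num (G f))"
    by (rule eval_App_Var) (simp_all add: appl_val2)
  then have "appl (Clo ?b (?r # val2 G # \<rho>)) (val1 f) (Num ((\<Sum>f\<leftarrow>fs. G f) + G f))"
    by (intro eval_appl_recn_recs.intros(13) eval_tm_add eval_Var) simp_all
  \<comment> \<open>The recursor treats the tail first, so the summand of the head arrives on the
    right, whereas \<open>sum_list\<close> has it on the left.\<close>
  ultimately show ?case
    using Cons.IH eval_appl_recn_recs.intros(20) by (simp add: add.commute)
qed

text \<open>The outer closure captures \<open>[x, y]\<close>, the environment of the whole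
  application; the two arguments are then pushed in turn, which explains the repetition.\<close>

lemma eval_app2_Lam:
  assumes "eval [y, x, x, y] b v"
  shows "eval [x, y] (App (App (Lam \<sigma> (Lam \<tau> b)) (Var 0)) (Var 1)) v"
proof -
  have "eval [x, y] (App (Lam \<sigma> (Lam \<tau> b)) (Var 0)) (Clo b [x, x, y])"
    by (rule eval_appl_recn_recs.intros(3)[OF eval_appl_recn_recs.intros(2) eval_Var
          eval_appl_recn_recs.intros(13)[OF eval_appl_recn_recs.intros(2)]]) simp_all
  then show ?thesis
    by (rule eval_appl_recn_recs.intros(3)[OF _ eval_Var
          eval_appl_recn_recs.intros(13)[OF assms]]) simp_all
qed

lemma app_SFF_eq: "app_SFF SFF_to_SCF \<Theta> G = ((\<Sum>f\<leftarrow>\<Theta> G. G f), \<Theta> G)"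
proof -
  let ?v = "PairV (Num (\<Sum>f\<leftarrow>\<Theta> G. G f)) (SeqV (map val1 (\<Theta> G)))"
  let ?\<rho> = "[val2 G, val_SFF \<Theta>, val_SFF \<Theta>, val2 G]"
  have \<Theta>: "eval ?\<rho> (App (Var 1) (Var 0)) (SeqV (map val1 (\<Theta> G)))"
    by (rule eval_App_Var) (simp_all add: appl_val_SFF)
  have "eval [val_SFF \<Theta>, val2 G] (App (App SFF_to_SCF (Var 0)) (Var 1)) ?v"
    unfolding SFF_to_SCF_def
    by (intro eval_app2_Lam eval_appl_recn_recs.intros(7) \<Theta>
        eval_appl_recn_recs.intros(12)[OF eval_appl_recn_recs.intros(4)
          eval_appl_recn_recs.intros(2) \<Theta> recs_sum])
  moreover have "reads_pair ?v ((\<Sum>f\<leftarrow>\<Theta> G. G f), \<Theta> G)"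
    unfolding reads_pair_def using reads_seq_val1 by simp
  \<comment> \<open>One evaluation with its reading suffices: well-definedness makes it the value of
    the description.\<close>
  ultimately show ?thesis
    unfolding app_SFF_def using app_SFF_welldef[OF has_type_SFF_to_SCF] by (blast intro: the1_equality)
qed

lemma app_SCF_eq: "app_SCF SCF_to_SFF \<nu> G = snd (\<nu> G)"
proof -
  let ?v = "SeqV (map val1 (snd (\<nu> G)))"
  have "eval [val2 G, val_SCF \<nu>, val_SCF \<nu>, val2 G] (App (Var 1) (Var 0)) (PairV (Num (fst (\<nu> G))) ?v)"
    by (rule eval_App_Var) (simp_all add: appl_val_SCF)
  then have "eval [val_SCF \<nu>, val2 G] (App (App SCF_to_SFF (Var 0)) (Var 1)) ?v"
    unfolding SCF_to_SFF_def
    by (intro eval_app2_Lam) (rule eval_appl_recn_recs.intros(9))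
  then show ?thesis
    unfolding app_SCF_def
    using app_SCF_welldef[OF has_type_SCF_to_SFF] reads_seq_val1 by (blast intro: the1_equality)
qed

lemma mem_cylinder_seg: "f \<in> cylinder (seg g n) \<longleftrightarrow> seg f n = seg g n"
  by (simp add: cylinder_def seg_def)

lemma SCF_if_SFF:
  assumes "SFF \<Theta>"
  shows "SCF (\<lambda>G. ((\<Sum>f\<leftarrow>\<Theta> G. G f), \<Theta> G))"
  unfolding SCF_def
proof (intro allI impI)
  fix G :: "(nat \<Rightarrow> nat) \<Rightarrow> nat" and T and \<beta> :: "nat \<Rightarrow> nat"
  assume T: "\<forall>\<alpha>\<in>set (snd ((\<Sum>f\<leftarrow>\<Theta> G. G f), \<Theta> G)). seg \<alpha> (G \<alpha>) \<notin> T" and "binary \<beta>"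
  then obtain g where g: "g \<in> set (\<Theta> G)" "seg \<beta> (G g) = seg g (G g)"
    using assms unfolding SFF_def mem_cylinder_seg by blast
  have "G g \<le> (\<Sum>f\<leftarrow>\<Theta> G. G f)"
    using g(1) by (intro member_le_sum_list) simp_all
  \<comment> \<open>The witness is \<open>i = G g\<close>: there \<beta> shares its segment with
    \<open>g\<close>, and that segment is outside \<open>T\<close>.\<close>
  then show "\<exists>i\<le>fst ((\<Sum>f\<leftarrow>\<Theta> G. G f), \<Theta> G). seg \<beta> i \<notin> T"
    using T g by auto
qed

text \<open>Makes the segments of a single function closed under prefixes, as a tree
  requires.\<close>

lemma prefix_segD:
  assumes "prefix \<tau> (seg f n)"
  shows "\<tau> = seg f (length \<tau>)"
proof (rule nth_equalityI)
  fix i assume "i < length \<tau>"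
  moreover have "length \<tau> \<le> n" using prefix_length_le[OF assms] by (simp add: seg_def)
  ultimately show "\<tau> ! i = seg f (length \<tau>) ! i"
    using assms by (auto simp: prefix_def seg_def nth_append dest!: arg_cong[of _ _ "\<lambda>xs. xs ! i"])
qed (simp add: seg_def)

lemma binary_tree_range_seg: "binary f \<Longrightarrow> binary_tree (range (seg f))"
  unfolding binary_tree_def
  by (auto simp: binary_def seg_def le_Suc_eq dest: prefix_segD[unfolded seg_def]) (metis neq0_conv)

lemma SFF_if_SCF:
  assumes "SCF \<nu>"
  shows "SFF (\<lambda>G. snd (\<nu> G))"
  unfolding SFF_def
proof (intro allI impI, rule ccontr)
  fix G and f :: "nat \<Rightarrow> nat"
  assume f: "binary f" and "\<not> (\<exists>g\<in>set (snd (\<nu> G)). f \<in> cylinder (seg g (G g)))"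
  \<comment> \<open>\<open>f\<close> lies in the cylinder of each of its own segments, so equality
    for any \<open>n\<close> would put it in an excluded cylinder.\<close>
  then have "seg g (G g) \<noteq> seg f n" if "g \<in> set (snd (\<nu> G))" for g n
    using that by (metis mem_cylinder_seg)
  \<comment> \<open>For the tree \<open>range (seg f)\<close> and \<beta> = \<open>f\<close>, the
    specification yields a segment of \<open>f\<close> outside the set of all its segments.\<close>
  then show False
    using assms f binary_tree_range_seg[OF f] unfolding SCF_def by blast
qed

theorem theorem2p23:
  shows "\<exists>s t.
     ([] \<turnstile> t : (ty2 \<rightarrow>\<^sub>T Star ty1) \<rightarrow>\<^sub>T ty2 \<rightarrow>\<^sub>T N \<times>\<^sub>T Star ty1) \<and>
     ([] \<turnstile> s : (ty2 \<rightarrow>\<^sub>T N \<times>\<^sub>T Star ty1) \<rightarrow>\<^sub>T ty2 \<rightarrow>\<^sub>T Star ty1) \<and>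
     (\<forall>\<Theta>. SFF \<Theta> \<longrightarrow> SCF (app_SFF t \<Theta>)) \<and>
     (\<forall>\<nu>. SCF \<nu> \<longrightarrow> SFF (app_SCF s \<nu>))"
proof (intro exI conjI allI impI)
  show "SCF (app_SFF SFF_to_SCF \<Theta>)" if "SFF \<Theta>" for \<Theta>
    using SCF_if_SFF[OF that] by (simp add: app_SFF_eq[abs_def])
  show "SFF (app_SCF SCF_to_SFF \<nu>)" if "SCF \<nu>" for \<nu>
    using SFF_if_SCF[OF that] by (simp add: app_SCF_eq[abs_def])
qed (rule has_type_SFF_to_SCF has_type_SCF_to_SFF)+

end
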